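(* Let $n\ge 2$ and let $r$ be a real number with $1/2<r<1$. There are constants $C,c_0>0$ depending only on $n$ and $r$ such that for every deterministic online algorithm $\mathrm{ALG}$ and every real $c>0$ there exists an input sequence $\sigma$ with $$\mathrm{ALG}(\sigma)\le \frac{\mathrm{OPT}(\sigma)}{n}-c ,$$ and, whenever $c\ge c_0$, $\sigma$ can be chosen so that in addition $\mathrm{OPT}(\sigma)\le C\,c^{3-r}$ (that is, $\mathrm{OPT}(\sigma)=O(c^{3-r})$).
   Context: Setting (online max-min fair allocation, adversarial arrival). There are agents $N=\{1,\dots,n\}$; a finite sequence $\sigma$ of items arrives one by one. On arrival of an item $e$ its value vector $(v_1(e),\dots,v_n(e))\in[0,1]^n$ is revealed, and $e$ must be irrevocably given to one agent; the number of items is not known in advance. Valuations are additive: $v_i(X)=\sum_{e\in X}v_i(e)$. A deterministic online algorithm's decision for an item is a function of the value vectors revealed so far (including that of the current item). $\mathrm{ALG}(\sigma)$ is $\min_{i\in N}v_i(A_i)$ for the allocation $(A_1,\dots,A_n)$ produced by the algorithm on $\sigma$, and $\mathrm{OPT}(\sigma)$ is the maximum of $\min_{i\in N}v_i(A_i)$ over all allocations (partitions of the items into $n$ parts). *)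

theory Defs
  imports Complex_Main "HOL-Library.FuncSet" "HOL-Library.Disjoint_Sets"
begin

text \<open>Agents are the numbers \<open>1, \<dots>, n\<close>. The items of an input sequence \<open>\<sigma>\<close> are its positions
  \<open>0, \<dots>, length \<sigma> - 1\<close>, so that distinct items may have equal value vectors. Value vectors are
  extensional functions: they carry no information beyond the \<open>n\<close> values.\<close>

definition agents :: "nat \<Rightarrow> nat set" where
  "agents n = {1..n}"

definition value_vectors :: "nat \<Rightarrow> (nat \<Rightarrow> real) set" where
  "value_vectors n = agents n \<rightarrow>\<^sub>E {0..1}"

definition input_sequences :: "nat \<Rightarrow> (nat \<Rightarrow> real) list set" where
  "input_sequences n = lists (value_vectors n)"

definition items :: "(nat \<Rightarrow> real) list \<Rightarrow> nat set" where
  "items \<sigma> = {..<length \<sigma>}"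

definition valuation :: "(nat \<Rightarrow> real) list \<Rightarrow> nat \<Rightarrow> nat set \<Rightarrow> real" where
  "valuation \<sigma> i X = (\<Sum>e\<in>X. (\<sigma> ! e) i)"

text \<open>Parts of an allocation may be empty.\<close>

definition allocations :: "nat \<Rightarrow> (nat \<Rightarrow> real) list \<Rightarrow> (nat \<Rightarrow> nat set) set" where
  "allocations n \<sigma> =
     {A \<in> agents n \<rightarrow>\<^sub>E Pow (items \<sigma>).
        disjoint_family_on A (agents n) \<and> (\<Union>i\<in>agents n. A i) = items \<sigma>}"

definition min_value :: "nat \<Rightarrow> (nat \<Rightarrow> real) list \<Rightarrow> (nat \<Rightarrow> nat set) \<Rightarrow> real" where
  "min_value n \<sigma> A = (MIN i\<in>agents n. valuation \<sigma> i (A i))"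

definition OPT :: "nat \<Rightarrow> (nat \<Rightarrow> real) list \<Rightarrow> real" where
  "OPT n \<sigma> = (MAX A\<in>allocations n \<sigma>. min_value n \<sigma> A)"

text \<open>A deterministic online algorithm maps the nonempty list of value vectors revealed so far, whose
  last entry belongs to the current item, to the agent that receives this item.\<close>

type_synonym online_rule = "(nat \<Rightarrow> real) list \<Rightarrow> nat"

definition online_algorithm :: "nat \<Rightarrow> online_rule \<Rightarrow> bool" where
  "online_algorithm n alg \<longleftrightarrow> (\<forall>\<sigma>\<in>input_sequences n. \<sigma> \<noteq> [] \<longrightarrow> alg \<sigma> \<in> agents n)"

definition online_allocation :: "nat \<Rightarrow> online_rule \<Rightarrow> (nat \<Rightarrow> real) list \<Rightarrow> nat \<Rightarrow> nat set" where
  "online_allocation n alg \<sigma> = (\<lambda>i\<in>agents n. {e \<in> items \<sigma>. alg (take (Suc e) \<sigma>) = i})"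

definition ALG :: "nat \<Rightarrow> online_rule \<Rightarrow> (nat \<Rightarrow> real) list \<Rightarrow> real" where
  "ALG n alg \<sigma> = min_value n \<sigma> (online_allocation n alg \<sigma>)"

text \<open>The minimum and the maximum above range over finite nonempty sets (for \<open>n \<ge> 1\<close>), and the
  outcome of an online algorithm is one of the allocations considered by \<open>OPT\<close>.\<close>

lemma finite_allocations: "finite (allocations n \<sigma>)"
proof -
  have "finite (agents n \<rightarrow>\<^sub>E Pow (items \<sigma>))"
    by (intro finite_PiE) (auto simp: agents_def items_def)
  then show ?thesis
    by (rule rev_finite_subset) (auto simp: allocations_def)
qed

lemma online_allocation_in_allocations:
  assumes "online_algorithm n alg" "\<sigma> \<in> input_sequences n"
  shows "online_allocation n alg \<sigma> \<in> allocations n \<sigma>"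
proof -
  have "alg (take (Suc e) \<sigma>) \<in> agents n" if "e \<in> items \<sigma>" for e
  proof -
    have "take (Suc e) \<sigma> \<in> input_sequences n"
      using assms(2) by (auto simp: input_sequences_def dest: in_set_takeD)
    moreover have "take (Suc e) \<sigma> \<noteq> []"
      using that by (auto simp: items_def)
    ultimately show ?thesis
      using assms(1) by (auto simp: online_algorithm_def)
  qed
  then show ?thesis
    by (auto simp: allocations_def online_allocation_def disjoint_family_on_def)
qed

lemma allocations_nonempty:
  assumes "n \<ge> 1" "\<sigma> \<in> input_sequences n"
  shows "allocations n \<sigma> \<noteq> {}"
proof -
  have "online_algorithm n (\<lambda>_. 1)"
    using assms(1) by (auto simp: online_algorithm_def agents_def)
  from online_allocation_in_allocations[OF this assms(2)] show ?thesis
    by blast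
qed

end

(* Let D_i = v_i(A_i) - v_i(M)/n be the surplus of agent i over a proportional share of the items M
   seen so far, and let W_i = exp (- l D_i). The adversary presents the item with v_i = min W / W_i.
   Whichever agent receives it, the first-order change of the potential sum_i W_i vanishes, and the
   second-order term makes the potential grow by a multiple of l^2 min W. The potential starts at n,
   so either min W drops below 1/2, and then some W_i exceeds 1 by a constant because the sum is
   still at least n, or the sum grows until some W_i does; this takes O(1/l^2) items. Choosing l of
   order 1/c, that agent i has D_i <= -c. Finally the adversary adds items that are worthless to i
   and plentiful for the others, so that OPT = v_i(M). This gives OPT = O(c^2), and c^2 <= c^(3-r). *)

theory Submission
  imports Defs
begin

section \<open>Surplus over the proportional share, and its exponential potential\<close>

definition surplus :: "nat \<Rightarrow> online_rule \<Rightarrow> (nat \<Rightarrow> real) list \<Rightarrow> nat \<Rightarrow> real" where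
  "surplus n alg \<sigma> i = (\<Sum>e<length \<sigma>. (\<sigma> ! e) i * (of_bool (alg (take (Suc e) \<sigma>) = i) - 1 / real n))"

definition potential :: "nat \<Rightarrow> online_rule \<Rightarrow> real \<Rightarrow> (nat \<Rightarrow> real) list \<Rightarrow> real" where
  "potential n alg l \<sigma> = (\<Sum>i\<in>agents n. exp (- l * surplus n alg \<sigma> i))"

lemma finite_agents [simp]: "finite (agents n)"
  by (simp add: agents_def)

lemma card_agents [simp]: "card (agents n) = n"
  by (simp add: agents_def)

lemma surplus_snoc:
  "surplus n alg (\<sigma> @ [u]) i =
     surplus n alg \<sigma> i + u i * (of_bool (alg (\<sigma> @ [u]) = i) - 1 / real n)"
proof -
  have "(\<Sum>e<length \<sigma>. ((\<sigma> @ [u]) ! e) i * (of_bool (alg (take (Suc e) (\<sigma> @ [u])) = i) - 1 / real n))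
      = surplus n alg \<sigma> i"
    unfolding surplus_def by (rule sum.cong) (auto simp: nth_append)
  then show ?thesis
    by (simp add: surplus_def)
qed

text \<open>Ties the itemwise sum to the surplus over a proportional share. The itemwise form is the
  one that changes by a single summand when an item is appended, since decisions on earlier items
  see only their own prefixes.\<close>

lemma surplus_eq_valuation:
  assumes "i \<in> agents n"
  shows "surplus n alg \<sigma> i =
           valuation \<sigma> i (online_allocation n alg \<sigma> i) - valuation \<sigma> i (items \<sigma>) / real n"
proof -
  have "valuation \<sigma> i (online_allocation n alg \<sigma> i) =
      (\<Sum>e<length \<sigma>. (\<sigma> ! e) i * of_bool (alg (take (Suc e) \<sigma>) = i))"
    using assms unfolding valuation_def online_allocation_def items_def
    by (auto intro!: sum.mono_neutral_cong_left)
  then show ?thesis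
    by (simp add: surplus_def valuation_def items_def right_diff_distrib sum_subtractf
        sum_divide_distrib)
qed

section \<open>The adversary's item and the growth of the potential\<close>

lemma exp_ge_quadratic:
  fixes x :: real
  assumes "x \<ge> -2"
  shows "1 + x + x\<^sup>2 / 4 \<le> exp x"
proof -
  have "(1 + x / 2)\<^sup>2 \<le> (exp (x / 2))\<^sup>2"
    using assms by (intro power_mono exp_ge_add_one_self) auto
  then show ?thesis
    using exp_double[of "x / 2"] by (simp add: power2_sum power_divide)
qed

text \<open>Scaling the values to \<open>min W / W_i\<close> makes every product
  \<open>W_i * u i\<close> equal, so the first-order changes are proportional to \<open>d i\<close>,
  which sum to 0 whoever receives the item. What remains is the quadratic term of the agent with the
  smallest \<open>W_i\<close>.\<close>

lemma exists_item_increasing_potential: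
  assumes n: "n \<ge> 2" and alg: "online_algorithm n alg" and \<sigma>: "\<sigma> \<in> input_sequences n"
    and l: "0 < l" "l \<le> 1"
    and w: "\<And>i. i \<in> agents n \<Longrightarrow> exp (- l * surplus n alg \<sigma> i) \<ge> w"
  shows "\<exists>u\<in>value_vectors n.
           potential n alg l (\<sigma> @ [u]) \<ge> potential n alg l \<sigma> + w * (l / n)\<^sup>2 / 4"
proof -
  define s where "s = surplus n alg \<sigma>"
  have ne: "agents n \<noteq> {}"
    using n by (auto simp: agents_def)
  \<comment> \<open>The largest surplus belongs to the smallest \<open>W_i\<close>, so
    \<open>m\<close> attains \<open>min W\<close>, and \<open>u m = 1\<close> below.\<close>
  have "Max (s ` agents n) \<in> s ` agents n"
    using ne by (intro Max_in) auto
  then obtain m where m: "m \<in> agents n" "s m = Max (s ` agents n)"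
    by auto
  have sm: "s i \<le> s m" if "i \<in> agents n" for i
    using that m by auto
  define u where "u = (\<lambda>i\<in>agents n. exp (l * (s i - s m)))"
  have u: "u \<in> value_vectors n"
    using l sm by (auto simp: u_def value_vectors_def mult_le_0_iff)
  define k where "k = alg (\<sigma> @ [u])"
  have "\<sigma> @ [u] \<in> input_sequences n"
    using \<sigma> u by (auto simp: input_sequences_def)
  then have k: "k \<in> agents n"
    using alg by (auto simp: online_algorithm_def k_def)
  define d where "d i = of_bool (k = i) - 1 / real n" for i
  have sum_d: "(\<Sum>i\<in>agents n. d i) = 0"
    using k n by (simp add: d_def sum_subtractf of_bool_def)
  have wu: "exp (- l * s i) * u i = exp (- l * s m)" if "i \<in> agents n" for i
    using that by (simp add: u_def mult_exp_exp algebra_simps)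
  \<comment> \<open>\<open>d m\<close> is either \<open>1 - 1/n\<close> or \<open>-1/n\<close>; in
    the first case the lower bound uses \<open>n\<close> at least 2.\<close>
  have dm: "1 / real n \<le> \<bar>d m\<bar>" "\<bar>d m\<bar> \<le> 1"
    using n by (auto simp: d_def field_simps)
  \<comment> \<open>Only \<open>m\<close> is credited with a second-order gain; for the other agents
    the tangent bound \<open>1 + x\<close> on \<open>exp x\<close> suffices.\<close>
  let ?b = "\<lambda>i. if i = m then w * (l / n)\<^sup>2 / 4 else 0"
  have bound: "exp (- l * s i) - l * exp (- l * s m) * d i + ?b i \<le> exp (- l * (s i + u i * d i))"
    if i: "i \<in> agents n" for i
  proof -
    let ?x = "- l * u i * d i"
    have "exp (- l * (s i + u i * d i)) = exp (- l * s i) * exp ?x"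
      by (simp add: mult_exp_exp algebra_simps)
    moreover have "exp (- l * s i) * (1 + ?x) + ?b i \<le> exp (- l * s i) * exp ?x"
    proof (cases "i = m")
      case True
      then have x: "?x = - l * d m"
        using i by (simp add: u_def)
      have "\<bar>- l * d m\<bar> \<le> 1"
        using l dm by (simp add: abs_mult mult_le_one)
      then have "1 + ?x + (l * d m)\<^sup>2 / 4 \<le> exp ?x"
        unfolding x using exp_ge_quadratic[of "- l * d m"] by auto
      moreover have "(l / n)\<^sup>2 \<le> (l * d m)\<^sup>2"
        using l mult_left_mono[OF dm(1), of l] by (intro abs_le_square_iff[THEN iffD1]) (simp add: abs_mult)
      ultimately have "exp (- l * s i) * (1 + ?x + (l / n)\<^sup>2 / 4) \<le> exp (- l * s i) * exp ?x"
        by (intro mult_left_mono) auto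
      moreover have "w * (l / n)\<^sup>2 / 4 \<le> exp (- l * s i) * ((l / n)\<^sup>2 / 4)"
        using w[OF i] by (simp add: s_def mult_right_mono divide_right_mono)
      ultimately show ?thesis
        using True by (simp add: algebra_simps)
    next
      case False
      then show ?thesis
        using exp_ge_add_one_self[of ?x] by (auto intro!: mult_left_mono)
    qed
    moreover have "exp (- l * s i) * (1 + ?x) = exp (- l * s i) - l * exp (- l * s m) * d i"
      using wu[OF i, symmetric] by (simp add: algebra_simps)
    ultimately show ?thesis by simp
  qed
  have "potential n alg l \<sigma> + w * (l / n)\<^sup>2 / 4 =
      (\<Sum>i\<in>agents n. exp (- l * s i) - l * exp (- l * s m) * d i + ?b i)"
    using m sum_d
    by (simp add: sum.distrib sum_subtractf sum_distrib_left[symmetric] potential_def s_def)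
  also have "\<dots> \<le> (\<Sum>i\<in>agents n. exp (- l * (s i + u i * d i)))"
    by (intro sum_mono bound)
  also have "\<dots> = potential n alg l (\<sigma> @ [u])"
    by (simp add: potential_def surplus_snoc s_def d_def k_def)
  finally show ?thesis
    using u by blast
qed

lemma ex_agent_gt_if_sum_gt:
  assumes "(\<Sum>i\<in>agents n. f i) > real n * b"
  shows "\<exists>i\<in>agents n. f i > b"
proof (rule ccontr)
  assume "\<not> ?thesis"
  then have "(\<Sum>i\<in>agents n. f i) \<le> (\<Sum>i\<in>agents n. b)"
    by (intro sum_mono) (auto simp: not_less)
  with assms show False by simp
qed

text \<open>Each round either finds some \<open>W_i\<close> already large and keeps the sequence,
  whence only an upper bound on the length, or appends an item that raises the potential by
  \<open>(l / n)^2 / 8\<close>.\<close>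

lemma potential_growth:
  assumes n: "n \<ge> 2" and alg: "online_algorithm n alg" and l: "0 < l" "l \<le> 1"
  shows "\<exists>\<sigma>\<in>input_sequences n. length \<sigma> \<le> t \<and>
     ((\<exists>i\<in>agents n. exp (- l * surplus n alg \<sigma> i) \<ge> 1 + 1 / (2 * real n)) \<or>
      potential n alg l \<sigma> \<ge> n + t * (l / n)\<^sup>2 / 8)"
proof (induction t)
  case 0
  show ?case
    by (rule bexI[of _ "[]"]) (auto simp: input_sequences_def potential_def surplus_def)
next
  case (Suc t)
  then obtain \<sigma> where \<sigma>: "\<sigma> \<in> input_sequences n" "length \<sigma> \<le> t"
    and disj: "(\<exists>i\<in>agents n. exp (- l * surplus n alg \<sigma> i) \<ge> 1 + 1 / (2 * real n)) \<or>
      potential n alg l \<sigma> \<ge> n + t * (l / n)\<^sup>2 / 8" by blast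
  show ?case
  proof (cases "\<exists>i\<in>agents n. exp (- l * surplus n alg \<sigma> i) \<ge> 1 + 1 / (2 * real n)")
    case True
    with \<sigma> show ?thesis by (intro bexI[of _ \<sigma>]) auto
  next
    case False
    with disj have pot: "potential n alg l \<sigma> \<ge> n + t * (l / n)\<^sup>2 / 8" by blast
    let ?W = "\<lambda>i. exp (- l * surplus n alg \<sigma> i)"
    \<comment> \<open>The sum of all \<open>W_j\<close> is at least \<open>n\<close> and the other
      \<open>n - 1\<close> terms are below \<open>1 + 1/(2n)\<close>, so no term can fall under 1/2.
      This supplies the lower bound \<open>w = 1/2\<close> for the next item.\<close>
    have "1 / 2 \<le> ?W i" if i: "i \<in> agents n" for i
    proof -
      have "real n \<le> n + t * (l / n)\<^sup>2 / 8" by simp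
      also note pot
      also have "potential n alg l \<sigma> = ?W i + (\<Sum>j\<in>agents n - {i}. ?W j)"
        unfolding potential_def using i by (simp add: sum.remove)
      also have "(\<Sum>j\<in>agents n - {i}. ?W j) \<le> (\<Sum>j\<in>agents n - {i}. 1 + 1 / (2 * real n))"
        using False by (intro sum_mono) (auto simp: not_le intro: less_imp_le)
      also have "\<dots> = (real n - 1) * (1 + 1 / (2 * real n))"
        using i n by (simp add: of_nat_diff)
      also have "\<dots> \<le> real n - 1 / 2"
        using n by (simp add: field_simps)
      finally show ?thesis by simp
    qed
    from exists_item_increasing_potential[OF n alg \<sigma>(1) l this]
    obtain u where u: "u \<in> value_vectors n"
      "potential n alg l (\<sigma> @ [u]) \<ge> potential n alg l \<sigma> + 1 / 2 * (l / n)\<^sup>2 / 4" by blast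
    have "potential n alg l (\<sigma> @ [u]) \<ge> n + Suc t * (l / n)\<^sup>2 / 8"
      using u(2) pot by (simp add: algebra_simps add_divide_distrib)
    moreover have "\<sigma> @ [u] \<in> input_sequences n"
      using \<sigma> u by (auto simp: input_sequences_def)
    ultimately show ?thesis
      using \<sigma>(2) by (intro bexI[of _ "\<sigma> @ [u]"]) auto
  qed
qed

lemma exists_sequence_small_surplus:
  assumes n: "n \<ge> 2" and alg: "online_algorithm n alg" and c: "c \<ge> 1"
  defines "a \<equiv> ln (1 + 1 / (2 * real n))"
  shows "\<exists>\<sigma>\<in>input_sequences n. \<exists>i\<in>agents n.
           surplus n alg \<sigma> i \<le> - c \<and> length \<sigma> \<le> (8 * (real n)\<^sup>2 / a\<^sup>2 + 1) * c\<^sup>2"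
proof -
  \<comment> \<open>With this scale, \<open>exp (- l * D)\<close> reaches
    \<open>1 + 1/(2n) = exp a\<close> exactly when \<open>D\<close> is at most
    \<open>- c\<close>.\<close>
  define l where "l = a / c"
  have a0: "0 < a"
    unfolding a_def using n by (intro ln_gt_zero) auto
  have "a \<le> 1 / (2 * real n)"
    unfolding a_def by (rule ln_add_one_self_le_self) auto
  also have "\<dots> \<le> 1"
    using n by simp
  finally have a1: "a \<le> 1" .
  have l: "0 < l" "l \<le> 1"
    using a0 a1 c by (auto simp: l_def)
  \<comment> \<open>Enough rounds for the guaranteed growth \<open>t * (l / n)^2 / 8\<close> to
    reach 1. The rounding up costs at most 1, hence at most \<open>c^2\<close>, which is the
    \<open>+ 1\<close> in the bound on the length.\<close>
  define t where "t = nat \<lceil>8 * (real n)\<^sup>2 * c\<^sup>2 / a\<^sup>2\<rceil>"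
  have "1 \<le> c\<^sup>2"
    using c by simp
  moreover have "0 \<le> 8 * (real n)\<^sup>2 * c\<^sup>2 / a\<^sup>2" by simp
  ultimately have t: "8 * (real n)\<^sup>2 * c\<^sup>2 / a\<^sup>2 \<le> t" "t \<le> (8 * (real n)\<^sup>2 / a\<^sup>2 + 1) * c\<^sup>2"
    unfolding t_def by (simp add: real_nat_ceiling_ge, simp add: algebra_simps, linarith)
  obtain \<sigma> where \<sigma>: "\<sigma> \<in> input_sequences n" "length \<sigma> \<le> t"
    and disj: "(\<exists>i\<in>agents n. exp (- l * surplus n alg \<sigma> i) \<ge> 1 + 1 / (2 * real n)) \<or>
      potential n alg l \<sigma> \<ge> n + t * (l / n)\<^sup>2 / 8"
    using potential_growth[OF n alg l] by blast
  have "\<exists>i\<in>agents n. exp (- l * surplus n alg \<sigma> i) \<ge> 1 + 1 / (2 * real n)"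
    using disj
  proof
    assume *: "potential n alg l \<sigma> \<ge> n + t * (l / n)\<^sup>2 / 8"
    have "1 = 8 * (real n)\<^sup>2 * c\<^sup>2 / a\<^sup>2 * (l / n)\<^sup>2 / 8"
      using a0 c n by (simp add: l_def field_simps)
    also have "\<dots> \<le> t * (l / n)\<^sup>2 / 8"
      using t(1) by (intro divide_right_mono mult_right_mono) auto
    \<comment> \<open>A potential of at least \<open>n + 1\<close> exceeds \<open>n + 1/2\<close>,
      so averaging yields the agent that the other disjunct gives directly.\<close>
    finally have "potential n alg l \<sigma> > real n * (1 + 1 / (2 * real n))"
      using * n by (simp add: algebra_simps)
    from ex_agent_gt_if_sum_gt[OF this[unfolded potential_def]] show ?thesis
      by (auto intro: less_imp_le)
  qed
  then obtain i where i: "i \<in> agents n" "exp (- l * surplus n alg \<sigma> i) \<ge> 1 + 1 / (2 * real n)"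
    by blast
  have "a \<le> ln (exp (- l * surplus n alg \<sigma> i))"
    unfolding a_def using i(2) by (intro ln_mono) (auto intro: add_pos_nonneg)
  then have "a * c \<le> a * - surplus n alg \<sigma> i"
    using c by (simp add: l_def field_simps)
  then have "surplus n alg \<sigma> i \<le> - c"
    using a0 by (simp only: mult_le_cancel_left_pos)
  with \<sigma> i(1) t(2) show ?thesis
    by (intro bexI[of _ \<sigma>] bexI[of _ i]) auto
qed

section \<open>Elementary bounds on the optimum\<close>

lemma OPT_ge:
  assumes "A \<in> allocations n \<sigma>"
  shows "min_value n \<sigma> A \<le> OPT n \<sigma>"
  unfolding OPT_def using assms by (intro Max_ge) (auto simp: finite_allocations)

lemma min_value_le:
  assumes "i \<in> agents n"
  shows "min_value n \<sigma> A \<le> valuation \<sigma> i (A i)"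
  unfolding min_value_def using assms by (intro Min_le) auto

text \<open>Values are nonnegative, so no allocation gives agent \<open>i\<close> more than the
  whole set of items.\<close>

lemma OPT_le_valuation:
  assumes i: "i \<in> agents n" and \<sigma>: "\<sigma> \<in> input_sequences n"
  shows "OPT n \<sigma> \<le> valuation \<sigma> i (items \<sigma>)"
proof -
  have n: "n \<ge> 1"
    using i by (auto simp: agents_def)
  have "min_value n \<sigma> A \<le> valuation \<sigma> i (items \<sigma>)" if A: "A \<in> allocations n \<sigma>" for A
  proof -
    have "min_value n \<sigma> A \<le> valuation \<sigma> i (A i)"
      by (rule min_value_le[OF i])
    also have "\<dots> \<le> valuation \<sigma> i (items \<sigma>)"
      unfolding valuation_def
    proof (rule sum_mono2)
      show "A i \<subseteq> items \<sigma>"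
        using A i by (auto simp: allocations_def)
      show "0 \<le> (\<sigma> ! e) i" if "e \<in> items \<sigma> - A i" for e
      proof -
        have "\<sigma> ! e \<in> value_vectors n"
          using that \<sigma> by (auto simp: items_def input_sequences_def in_lists_conv_set)
        then show ?thesis
          using i by (auto simp: value_vectors_def)
      qed
    qed (simp add: items_def)
    finally show ?thesis .
  qed
  then show ?thesis
    unfolding OPT_def using allocations_nonempty[OF n \<sigma>] by (intro Max.boundedI) (auto simp: finite_allocations)
qed

lemma valuation_items_le_length:
  assumes "i \<in> agents n" and "\<sigma> \<in> input_sequences n"
  shows "valuation \<sigma> i (items \<sigma>) \<le> length \<sigma>"
proof -
  have "(\<sigma> ! e) i \<le> 1" if "e \<in> items \<sigma>" for e
  proof -
    have "\<sigma> ! e \<in> value_vectors n"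
      using that assms(2) by (auto simp: items_def input_sequences_def in_lists_conv_set)
    then show ?thesis
      using assms(1) by (auto simp: value_vectors_def)
  qed
  then have "valuation \<sigma> i (items \<sigma>) \<le> (\<Sum>e\<in>items \<sigma>. 1)"
    unfolding valuation_def by (intro sum_mono)
  then show ?thesis by (simp add: items_def)
qed

lemma allocation_of_assignment:
  assumes "\<And>e. e \<in> items \<sigma> \<Longrightarrow> g e \<in> agents n"
  shows "(\<lambda>k\<in>agents n. {e \<in> items \<sigma>. g e = k}) \<in> allocations n \<sigma>"
  using assms by (auto simp: allocations_def disjoint_family_on_def)

section \<open>Padding with items that are worthless to one agent\<close>

definition worthless_only_to :: "nat \<Rightarrow> nat \<Rightarrow> nat \<Rightarrow> real" where
  "worthless_only_to n i = (\<lambda>k\<in>agents n. of_bool (k \<noteq> i))"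

text \<open>One block of \<open>length \<sigma>\<close> items for each agent. The block of agent
  \<open>i\<close> itself has no value to \<open>i\<close>; it keeps the block numbering
  uniform.\<close>

definition padding :: "nat \<Rightarrow> nat \<Rightarrow> (nat \<Rightarrow> real) list \<Rightarrow> (nat \<Rightarrow> real) list" where
  "padding n i \<sigma> = replicate (n * length \<sigma>) (worthless_only_to n i)"

lemma padded_input_sequence:
  assumes "\<sigma> \<in> input_sequences n"
  shows "\<sigma> @ padding n i \<sigma> \<in> input_sequences n"
  using assms
  by (auto simp: input_sequences_def padding_def worthless_only_to_def value_vectors_def in_lists_conv_set)

lemma nth_padded:
  assumes "length \<sigma> \<le> e" "e \<in> items (\<sigma> @ padding n i \<sigma>)" "k \<in> agents n"
  shows "((\<sigma> @ padding n i \<sigma>) ! e) k = of_bool (k \<noteq> i)"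
  using assms by (auto simp: nth_append items_def padding_def worthless_only_to_def)

lemma valuation_padded:
  assumes "i \<in> agents n"
  shows "valuation (\<sigma> @ padding n i \<sigma>) i (items (\<sigma> @ padding n i \<sigma>)) = valuation \<sigma> i (items \<sigma>)"
  unfolding valuation_def items_def
  using assms by (intro sum.mono_neutral_cong_right)
    (auto simp: nth_append padding_def worthless_only_to_def)

text \<open>Padding items contribute 0 to agent \<open>i\<close> whatever the algorithm does with
  them, and decisions on \<open>\<sigma>\<close> are fixed before they arrive.\<close>

lemma surplus_padded:
  assumes "i \<in> agents n"
  shows "surplus n alg (\<sigma> @ padding n i \<sigma>) i = surplus n alg \<sigma> i"
  unfolding surplus_def
  using assms by (intro sum.mono_neutral_cong_right)
    (auto simp: nth_append padding_def worthless_only_to_def)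

text \<open>Agent \<open>i\<close> gains nothing from the padding, which gives the upper bound.
  Conversely \<open>i\<close> can take all of \<open>\<sigma>\<close>, while each other agent takes
  a block worth \<open>length \<sigma>\<close>, at least as much because values are at most
  1.\<close>

lemma OPT_padded:
  assumes i: "i \<in> agents n" and \<sigma>: "\<sigma> \<in> input_sequences n"
  shows "OPT n (\<sigma> @ padding n i \<sigma>) = valuation \<sigma> i (items \<sigma>)"
proof (rule antisym)
  let ?\<tau> = "\<sigma> @ padding n i \<sigma>"
  show "OPT n ?\<tau> \<le> valuation \<sigma> i (items \<sigma>)"
    using OPT_le_valuation[OF i padded_input_sequence[OF \<sigma>], of i] valuation_padded[OF i, of \<sigma>]
    by simp
  define L where "L = length \<sigma>"
  \<comment> \<open>Since the padding starts at position \<open>L\<close> and agents are numbered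
    from 1, block \<open>k\<close> occupies the positions from \<open>k * L\<close> to
    \<open>k * L + L - 1\<close>, and division by \<open>L\<close> recovers its owner.\<close>
  define g where "g e = (if e < L then i else e div L)" for e
  have len: "items ?\<tau> = {..<L + n * L}"
    by (simp add: items_def padding_def L_def)
  have g: "g e \<in> agents n" if "e \<in> items ?\<tau>" for e
  proof (cases "e < L")
    case False
    \<comment> \<open>If \<open>L\<close> were 0, there would be no items at all.\<close>
    then have "L > 0" "L \<le> e" "e < Suc n * L"
      using that len by (cases L; auto)+
    then have "1 \<le> e div L" "e div L < Suc n"
      by (auto simp: less_mult_imp_div_less div_greater_zero_iff Suc_le_eq)
    then show ?thesis
      using False by (auto simp: g_def agents_def)
  qed (use i in \<open>simp add: g_def\<close>)
  define A where "A = (\<lambda>k\<in>agents n. {e \<in> items ?\<tau>. g e = k})"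
  have A: "A \<in> allocations n ?\<tau>"
    unfolding A_def by (rule allocation_of_assignment) (rule g)
  have "valuation \<sigma> i (items \<sigma>) \<le> valuation ?\<tau> k (A k)" if k: "k \<in> agents n" for k
  proof (cases "k = i")
    case True
    have "valuation ?\<tau> i (A i) = valuation \<sigma> i (items \<sigma>)"
      unfolding valuation_def
    proof (rule sum.mono_neutral_cong_right)
      show "items \<sigma> \<subseteq> A i"
        using i by (auto simp: A_def g_def L_def items_def)
      show "\<forall>e\<in>A i - items \<sigma>. (?\<tau> ! e) i = 0"
        using i nth_padded[of \<sigma> _ n i i] by (auto simp: A_def items_def)
    qed (use i in \<open>auto simp: A_def items_def nth_append\<close>)
    then show ?thesis
      using True by simp
  next
    case False
    have k1: "1 \<le> k" "k \<le> n"
      using k by (auto simp: agents_def)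
    have "{k * L..<k * L + L} \<subseteq> A k"
    proof
      fix e assume e: "e \<in> {k * L..<k * L + L}"
      then have "e div L = k"
        by (intro div_nat_eqI) (auto simp: algebra_simps)
      moreover have "L \<le> e"
        using e mult_le_mono1[OF k1(1), of L] by (simp only: atLeastLessThan_iff nat_mult_1) linarith
      moreover have "e < L + n * L"
        using e mult_le_mono1[OF k1(2), of L] by (simp only: atLeastLessThan_iff) linarith
      ultimately show "e \<in> A k"
        using k by (auto simp: A_def len g_def)
    qed
    then have "card {k * L..<k * L + L} \<le> card (A k)"
      using k by (intro card_mono) (auto simp: A_def items_def)
    moreover have "valuation ?\<tau> k (A k) = (\<Sum>e\<in>A k. 1)"
      unfolding valuation_def
    proof (rule sum.cong)
      fix e assume "e \<in> A k"
      then have "L \<le> e" "e < L + n * L"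
        using k False by (auto simp: A_def g_def len not_less split: if_splits)
      then show "(?\<tau> ! e) k = 1"
        using k False nth_padded[of \<sigma> e n i k] by (simp add: L_def len)
    qed simp
    ultimately have "real L \<le> valuation ?\<tau> k (A k)" by simp
    then show ?thesis
      using valuation_items_le_length[OF i \<sigma>] by (simp add: L_def)
  qed
  then have "valuation \<sigma> i (items \<sigma>) \<le> min_value n ?\<tau> A"
    unfolding min_value_def using i by (intro Min.boundedI) auto
  also have "\<dots> \<le> OPT n ?\<tau>"
    by (rule OPT_ge[OF A])
  finally show "valuation \<sigma> i (items \<sigma>) \<le> OPT n ?\<tau>" .
qed

section \<open>Assembling the lower bound\<close>

theorem theorem6:
  fixes n :: nat and r :: real
  assumes "n \<ge> 2" and "1/2 < r" and "r < 1"
  shows "\<exists>C>0. \<exists>c0>0. \<forall>alg. online_algorithm n alg \<longrightarrow>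
           (\<forall>c::real. c > 0 \<longrightarrow>
             (\<exists>\<sigma>\<in>input_sequences n.
                ALG n alg \<sigma> \<le> OPT n \<sigma> / real n - c \<and>
                (c \<ge> c0 \<longrightarrow> OPT n \<sigma> \<le> C * c powr (3 - r))))"
proof -
  define C where "C = 8 * (real n)\<^sup>2 / (ln (1 + 1 / (2 * real n)))\<^sup>2 + 1"
  have C: "C > 0"
    unfolding C_def by (intro add_nonneg_pos) auto
  have "\<exists>\<tau>\<in>input_sequences n. ALG n alg \<tau> \<le> OPT n \<tau> / real n - c \<and>
          (c \<ge> 1 \<longrightarrow> OPT n \<tau> \<le> C * c powr (3 - r))"
    if alg: "online_algorithm n alg" for alg c
  proof -
    \<comment> \<open>Small \<open>c\<close> are covered by the sequence for 1, which loses even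
      more; from the threshold 1 on, \<open>c'\<close> is \<open>c\<close> itself.\<close>
    define c' where "c' = max c 1"
    obtain \<sigma> i where \<sigma>: "\<sigma> \<in> input_sequences n" and i: "i \<in> agents n"
      and s: "surplus n alg \<sigma> i \<le> - c'" and len: "length \<sigma> \<le> C * c'\<^sup>2"
      using exists_sequence_small_surplus[OF assms(1) alg, of c'] unfolding C_def c'_def by auto
    define \<tau> where "\<tau> = \<sigma> @ padding n i \<sigma>"
    have opt: "OPT n \<tau> = valuation \<sigma> i (items \<sigma>)"
      unfolding \<tau>_def by (rule OPT_padded[OF i \<sigma>])
    have "ALG n alg \<tau> \<le> valuation \<tau> i (online_allocation n alg \<tau> i)"
      unfolding ALG_def by (rule min_value_le[OF i])
    also have "\<dots> = surplus n alg \<tau> i + valuation \<tau> i (items \<tau>) / real n"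
      by (simp add: surplus_eq_valuation[OF i])
    \<comment> \<open>After padding, the proportional share of \<open>i\<close> is exactly
      \<open>OPT / n\<close>, so the deficit of \<open>i\<close> becomes the additive loss of the
      algorithm.\<close>
    also have "\<dots> = surplus n alg \<sigma> i + OPT n \<tau> / real n"
      unfolding opt by (simp add: \<tau>_def surplus_padded[OF i] valuation_padded[OF i])
    also have "\<dots> \<le> OPT n \<tau> / real n - c"
      using s by (simp add: c'_def)
    finally have "ALG n alg \<tau> \<le> OPT n \<tau> / real n - c" .
    moreover have "OPT n \<tau> \<le> C * c powr (3 - r)" if "c \<ge> 1"
    proof -
      have "OPT n \<tau> \<le> C * c\<^sup>2"
        using opt valuation_items_le_length[OF i \<sigma>] len that by (simp add: c'_def)
      also have "c\<^sup>2 = c powr 2"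
        using that by simp
      \<comment> \<open>Here \<open>r < 1\<close> gives an exponent \<open>3 - r\<close> above 2,
        and the base is at least 1.\<close>
      also have "C * c powr 2 \<le> C * c powr (3 - r)"
        using that assms C by (intro mult_left_mono powr_mono) auto
      finally show ?thesis .
    qed
    moreover have "\<tau> \<in> input_sequences n"
      unfolding \<tau>_def by (rule padded_input_sequence[OF \<sigma>])
    ultimately show ?thesis by blast
  qed
  then show ?thesis
    using C by (intro exI[of _ C] conjI exI[of _ "1::real"]) auto
qed

end
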